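(* Let $n$ be the size of the outsourced dataset. The randomized oblivious storage scheme based on the optimized Melbourne shuffle has the following properties: (1) the private memory at the client and each message exchanged between the client and the server have size $O(\sqrt n)$; (2) the memory at the server has size $O(n)$; (3) the access overhead to perform a storage request is $O(1)$.
   Context: Access overhead: the amortized number of server operations (I/Os) executed per storage request read$(x)$ or write$(x,v')$. Sizes are measured in number of elements. A server operation reads or writes one or several contiguous ranges of elements (getRange, putRange, getRangeDist, putRangeDist); its message size is the total number of elements transferred. Optimized Melbourne shuffle: a data-oblivious shuffle $\mathrm{shuffle}(I,\pi,O)$ of an encrypted array $I$ of $N$ elements into re-encryptions arranged according to $\pi$ in $O$ (element with key $x$ at position $\pi(x)$), working as follows. Run a pass for a random permutation $\pi_1$ and then a pass, on the result, for $\pi$. In a pass for $\rho$, arrays are split into $\sqrt N$ consecutive buckets, grouped into $N^{1/4}$ chunks of $N^{1/4}$ buckets; constants $p_1,p_2>1$ are fixed. Phase I: read each bucket of $I$ (size $\sqrt N$) and, for every chunk of $O$, write to the corresponding chunk of a temporary array $T_1$ (size $p_1N$) a batch of those elements whose target position under $\rho$ lies in that chunk, padded with dummies to exactly $p_1N^{1/4}$ elements. Phase II: read each bucket of $T_1$ (size $p_1\sqrt N$) and, for every bucket in the same chunk of $O$, write to the corresponding bucket of a temporary array $T_2$ (size $p_2N$) a batch of the real elements targeted there, padded with dummies to exactly $p_2N^{1/4}$. The algorithm fails if a batch exceeds its size. Clean-up: read each bucket of $T_2$ (size $p_2\sqrt N$), remove dummies, sort by $\rho$, write the $\sqrt N$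 real elements to the bucket of $O$. All batches from one bucket are written in one operation; all data are re-encrypted when written. Oblivious storage scheme. Setup: the client extends the dataset of $n$ items with keys $1,\dots,n$ by $\sqrt n$ fake elements with keys $n+1,\dots,n+\sqrt n$, encrypts it, stores it at the server as $I$, picks a secret pseudo-random permutation $\pi$, runs $\mathrm{shuffle}(I,\pi,O)$ and sets $I\leftarrow O$; it also allocates at the server an empty encrypted cache $C$ with room for $\sqrt n$ elements. The client keeps only the encryption key and the seed of $\pi$ between requests. Access for key $x$: read and decrypt $C$ (with $l$ elements present); if $x$ is in $C$, read the fake element at position $\pi(n+l)$ of $I$, otherwise read position $\pi(x)$ of $I$; write the (updated) element encrypted to the first empty location of $C$. Rebuild, after every $\sqrt n$ requests: read $C$ into private memory, read the buckets of $I$ of size $\sqrt n$ one by one, update them with the elements of $C$ and write them back re-encrypted; then pick a fresh secret permutation $\pi'$, run $\mathrm{shuffle}(I,\pi',O)$, set $I\leftarrow O$, and empty $C$. *)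

theory Defs
  imports Complex_Main "HOL-Library.Landau_Symbols" "HOL-Combinatorics.Permutations"
begin

datatype 'v elem = Elem nat 'v | Dummy

text \<open>The real (non-dummy) elements of a list, as (key, value) pairs. The cache may hold several
  versions of one element; the one written last is the current one.\<close>

definition contents :: "'v elem list \<Rightarrow> (nat \<times> 'v) list" where
  "contents es = [(x, v). Elem x v \<leftarrow> es]"

definition lookup :: "nat \<Rightarrow> 'v elem list \<Rightarrow> 'v option" where
  "lookup x es = map_of (rev (contents es)) x"

datatype 'v request = Read nat | Write nat 'v

primrec request_key :: "'v request \<Rightarrow> nat" where
  "request_key (Read x) = x"
| "request_key (Write x v) = x"

definition valid_requests :: "nat \<Rightarrow> 'v request list \<Rightarrow> bool" where
  "valid_requests n reqs \<longleftrightarrow> (\<forall>r \<in> set reqs. request_key r \<in> {1..n})"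

text \<open>Randomised encryption (the second argument of \<open>enc\<close> is the nonce) and a family of seeded
  permutations: \<open>prp E sd N\<close> permutes the keys \<open>1, \<dots>, N\<close>.\<close>

record ('k, 'sd, 'r, 'v, 'c) crypto =
  enc :: "'k \<Rightarrow> 'r \<Rightarrow> 'v elem \<Rightarrow> 'c"
  dec :: "'k \<Rightarrow> 'c \<Rightarrow> 'v elem"
  prp :: "'sd \<Rightarrow> nat \<Rightarrow> nat \<Rightarrow> nat"

definition valid_crypto :: "('k, 'sd, 'r, 'v, 'c) crypto \<Rightarrow> bool" where
  "valid_crypto E \<longleftrightarrow>
     (\<forall>k r e. dec E k (enc E k r e) = e) \<and> (\<forall>sd N. prp E sd N permutes {1..N})"

datatype area = Arr_I | Arr_O | Arr_T1 | Arr_T2 | Arr_C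

text \<open>An area that is not allocated is the empty list. All memory is held by the five areas.\<close>

type_synonym 'c server = "area \<Rightarrow> 'c list"

definition server_size :: "'c server \<Rightarrow> nat" where
  "server_size \<sigma> = (\<Sum>a\<in>UNIV. length (\<sigma> a))"

text \<open>\<open>Get\<close> reads ranges given by offset and length, \<open>Put\<close> overwrites the ranges given by offset
  and new contents; with one range they are getRange and putRange, with several ranges
  getRangeDist and putRangeDist. The control operations that allocate, release and rename arrays
  transfer no elements, but they are counted as server operations all the same.\<close>

datatype 'c operation =
  Get area "(nat \<times> nat) list"
| Put area "(nat \<times> 'c list) list"
| Alloc area nat
| Free area
| Move area area

primrec message_size :: "'c operation \<Rightarrow> nat" where
  "message_size (Get a rs) = (\<Sum>(i, l)\<leftarrow>rs. l)"
| "message_size (Put a ws) = (\<Sum>(i, ys)\<leftarrow>ws. length ys)"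
| "message_size (Alloc a m) = 0"
| "message_size (Free a) = 0"
| "message_size (Move a b) = 0"

definition overwrite :: "nat \<times> 'c list \<Rightarrow> 'c list \<Rightarrow> 'c list" where
  "overwrite = (\<lambda>(i, ys) xs.
     map (\<lambda>j. if i \<le> j \<and> j < i + length ys then ys ! (j - i) else xs ! j) [0..<length xs])"

text \<open>The second component is the response of the server. Freshly allocated cells have
  unspecified contents.\<close>

primrec perform :: "'c operation \<Rightarrow> 'c server \<Rightarrow> 'c server \<times> 'c list" where
  "perform (Get a rs) \<sigma> = (\<sigma>, concat (map (\<lambda>(i, l). take l (drop i (\<sigma> a))) rs))"
| "perform (Put a ws) \<sigma> = (\<sigma>(a := fold overwrite ws (\<sigma> a)), [])"
| "perform (Alloc a m) \<sigma> = (\<sigma>(a := replicate m undefined), [])"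
| "perform (Free a) \<sigma> = (\<sigma>(a := []), [])"
| "perform (Move a b) \<sigma> = (\<sigma>(b := \<sigma> a, a := []), [])"

text \<open>The private memory. \<open>seed\<close> is the seed of the current permutation, \<open>aux_seed\<close> that of the
  intermediate permutation of a shuffle. \<open>inbox\<close> holds the last response of the server, \<open>outbox\<close>
  the ciphertexts to be sent next, \<open>cache\<close> and \<open>work\<close> hold decrypted elements.\<close>

record ('k, 'sd, 'v, 'c) client =
  key :: 'k
  seed :: "'sd option"
  aux_seed :: "'sd option"
  req :: "'v request option"
  answer :: "'v option"
  cache :: "'v elem list"
  work :: "'v elem list"
  inbox :: "'c list"
  outbox :: "(nat \<times> 'c list) list"

text \<open>The key, a seed, a request and an answer count as one element each.\<close>

definition private_size :: "('k, 'sd, 'v, 'c) client \<Rightarrow> nat" where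
  "private_size c = 1 + card (set_option (seed c)) + card (set_option (aux_seed c))
     + card (set_option (req c)) + card (set_option (answer c))
     + length (cache c) + length (work c) + length (inbox c) + (\<Sum>(i, ys)\<leftarrow>outbox c. length ys)"

text \<open>A program of the client is a list of instructions; the only data passed from one instruction
  to the next are the private memory and the server memory. A local computation has access to
  fresh coins (a seed and a family of nonces) and yields \<open>None\<close> if the algorithm fails. When an
  operation is executed, the outbox is emptied and the response replaces the inbox.\<close>

type_synonym ('sd, 'r) coins = "'sd \<times> (nat \<Rightarrow> nat \<Rightarrow> 'r)"

datatype ('k, 'sd, 'r, 'v, 'c) instr =
  Local "('sd, 'r) coins \<Rightarrow> ('k, 'sd, 'v, 'c) client \<Rightarrow> ('k, 'sd, 'v, 'c) client option"
| Op "('k, 'sd, 'v, 'c) client \<Rightarrow> 'c operation"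

type_synonym ('k, 'sd, 'v, 'c) config = "('k, 'sd, 'v, 'c) client \<times> 'c server"

text \<open>An event is the operation executed in a step, if any, and the configuration reached.\<close>

type_synonym ('k, 'sd, 'v, 'c) event = "'c operation option \<times> ('k, 'sd, 'v, 'c) config"

primrec step :: "('sd, 'r) coins \<Rightarrow> ('k, 'sd, 'r, 'v, 'c) instr \<Rightarrow> ('k, 'sd, 'v, 'c) config
    \<Rightarrow> ('k, 'sd, 'v, 'c) event option" where
  "step w (Local f) s = (case f w (fst s) of None \<Rightarrow> None | Some c \<Rightarrow> Some (None, c, snd s))"
| "step w (Op g) s = (let opn = g (fst s); (\<sigma>, resp) = perform opn (snd s)
     in Some (Some opn, (fst s)\<lparr>inbox := resp, outbox := []\<rparr>, \<sigma>))"

text \<open>All events of an execution, up to failure; \<open>\<omega> t\<close> are the coins of the step at time \<open>t\<close>.\<close>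

primrec exec :: "(nat \<Rightarrow> ('sd, 'r) coins) \<Rightarrow> nat \<Rightarrow> ('k, 'sd, 'r, 'v, 'c) instr list
    \<Rightarrow> ('k, 'sd, 'v, 'c) config \<Rightarrow> ('k, 'sd, 'v, 'c) event list" where
  "exec \<omega> t [] s = []"
| "exec \<omega> t (i # is) s =
     (case step (\<omega> t) i s of None \<Rightarrow> [] | Some e \<Rightarrow> e # exec \<omega> (Suc t) is (snd e))"

definition Compute :: "(('sd, 'r) coins \<Rightarrow> ('k, 'sd, 'v, 'c) client \<Rightarrow> ('k, 'sd, 'v, 'c) client)
    \<Rightarrow> ('k, 'sd, 'r, 'v, 'c) instr" where
  "Compute f = Local (\<lambda>w c. Some (f w c))"

text \<open>Encryption of the elements to be written; every element gets a nonce of its own.\<close>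

definition seal :: "('k, 'sd, 'r, 'v, 'c) crypto \<Rightarrow> 'k \<Rightarrow> (nat \<Rightarrow> nat \<Rightarrow> 'r)
    \<Rightarrow> (nat \<times> 'v elem list) list \<Rightarrow> (nat \<times> 'c list) list" where
  "seal E k r ws = map (\<lambda>j. (fst (ws ! j),
     map (\<lambda>i. enc E k (r j i) (snd (ws ! j) ! i)) [0..<length (snd (ws ! j))])) [0..<length ws]"

definition get :: "area \<Rightarrow> nat \<Rightarrow> nat \<Rightarrow> ('k, 'sd, 'r, 'v, 'c) instr" where
  "get a i l = Op (\<lambda>_. Get a [(i, l)])"

definition put :: "area \<Rightarrow> ('k, 'sd, 'r, 'v, 'c) instr" where
  "put a = Op (\<lambda>c. Put a (outbox c))"

definition decrypt_work :: "('k, 'sd, 'r, 'v, 'c) crypto \<Rightarrow> ('k, 'sd, 'r, 'v, 'c) instr" where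
  "decrypt_work E = Compute (\<lambda>_ c. c\<lparr>work := map (dec E (key c)) (inbox c)\<rparr>)"

definition decrypt_cache :: "('k, 'sd, 'r, 'v, 'c) crypto \<Rightarrow> ('k, 'sd, 'r, 'v, 'c) instr" where
  "decrypt_cache E = Compute (\<lambda>_ c. c\<lparr>cache := map (dec E (key c)) (inbox c)\<rparr>)"

definition wipe :: "('k, 'sd, 'r, 'v, 'c) instr" where
  "wipe = Compute (\<lambda>_ c. \<lparr>key = key c, seed = seed c, aux_seed = None, req = None, answer = None,
     cache = [], work = [], inbox = [], outbox = []\<rparr>)"

text \<open>Roots are rounded up: \<open>fakes n\<close> is \<open>\<surd>n\<close> (number of fake elements, room in the cache, period
  of the rebuilds), \<open>total n\<close> is \<open>N\<close>, and \<open>quart n\<close> is \<open>N\<close> to the power \<open>1/4\<close>.\<close>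

definition fakes :: "nat \<Rightarrow> nat" where
  "fakes n = nat \<lceil>sqrt (real n)\<rceil>"

definition total :: "nat \<Rightarrow> nat" where
  "total n = n + fakes n"

definition quart :: "nat \<Rightarrow> nat" where
  "quart n = nat \<lceil>root 4 (real (total n))\<rceil>"

text \<open>An array of \<open>N\<close> elements is split into \<open>(quart n)\<^sup>2\<close> consecutive buckets whose sizes differ by
  at most one; bucket \<open>k\<close> starts at this position, and chunk \<open>j\<close> consists of the buckets
  \<open>j * quart n, \<dots>, (j + 1) * quart n - 1\<close>. If \<open>N\<close> is a fourth power, every bucket has size
  \<open>\<surd>N\<close>.\<close>

definition bucket_start :: "nat \<Rightarrow> nat \<Rightarrow> nat" where
  "bucket_start n k = k * total n div (quart n)\<^sup>2"

definition bucket_size :: "nat \<Rightarrow> nat \<Rightarrow> nat" where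
  "bucket_size n k = bucket_start n (Suc k) - bucket_start n k"

text \<open>The batch size \<open>p N^(1/4)\<close>.\<close>

definition batch :: "real \<Rightarrow> nat \<Rightarrow> nat" where
  "batch p n = nat \<lceil>p * real (quart n)\<rceil>"

text \<open>Cells are numbered from 0, so the element with key \<open>x\<close> belongs in cell \<open>\<rho> x - 1\<close>.\<close>

primrec targeted :: "(nat \<Rightarrow> nat) \<Rightarrow> nat \<Rightarrow> nat \<Rightarrow> 'v elem \<Rightarrow> bool" where
  "targeted \<rho> lo hi (Elem x v) \<longleftrightarrow> lo \<le> \<rho> x - 1 \<and> \<rho> x - 1 < hi"
| "targeted \<rho> lo hi Dummy \<longleftrightarrow> False"

text \<open>Every triple \<open>(a, lo, hi)\<close> stands for a batch to be written at offset \<open>a\<close>, made of the elements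
  in \<open>work\<close> whose target lies in \<open>{lo..<hi}\<close> and padded to size \<open>m\<close>. The seed of the permutation is
  taken from the private memory by \<open>sel\<close>.\<close>

definition distribute :: "('k, 'sd, 'r, 'v, 'c) crypto \<Rightarrow> nat
    \<Rightarrow> (('k, 'sd, 'v, 'c) client \<Rightarrow> 'sd option) \<Rightarrow> nat \<Rightarrow> (nat \<times> nat \<times> nat) list
    \<Rightarrow> ('k, 'sd, 'r, 'v, 'c) instr" where
  "distribute E n sel m ts = Local (\<lambda>w c.
     let \<rho> = prp E (the (sel c)) (total n);
         bs = map (\<lambda>(a, lo, hi). (a, filter (targeted \<rho> lo hi) (work c))) ts
     in if \<exists>(a, es) \<in> set bs. length es > m then None
        else Some (c\<lparr>outbox := seal E (key c) (snd w)
               (map (\<lambda>(a, es). (a, es @ replicate (m - length es) Dummy)) bs)\<rparr>))"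

text \<open>Chunk \<open>j\<close> of \<open>T1\<close> holds, for every bucket \<open>k\<close> of the source, the batch from \<open>k\<close> to \<open>j\<close>.\<close>

definition phase1 :: "('k, 'sd, 'r, 'v, 'c) crypto \<Rightarrow> real \<Rightarrow> nat
    \<Rightarrow> (('k, 'sd, 'v, 'c) client \<Rightarrow> 'sd option) \<Rightarrow> area \<Rightarrow> nat
    \<Rightarrow> ('k, 'sd, 'r, 'v, 'c) instr list" where
  "phase1 E p1 n sel src k = (let q = quart n; m = batch p1 n in
     [get src (bucket_start n k) (bucket_size n k),
      decrypt_work E,
      distribute E n sel m
        (map (\<lambda>j. (j * (q\<^sup>2 * m) + k * m, bucket_start n (j * q), bucket_start n (Suc j * q))) [0..<q]),
      put Arr_T1])"

text \<open>Bucket \<open>t\<close> of \<open>T1\<close> is bucket number \<open>t mod q\<close> of chunk \<open>t div q\<close>. Bucket \<open>b\<close> of \<open>T2\<close> holds,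
  for every bucket of its chunk of \<open>T1\<close>, the batch from there to \<open>b\<close>.\<close>

definition phase2 :: "('k, 'sd, 'r, 'v, 'c) crypto \<Rightarrow> real \<Rightarrow> real \<Rightarrow> nat
    \<Rightarrow> (('k, 'sd, 'v, 'c) client \<Rightarrow> 'sd option) \<Rightarrow> nat \<Rightarrow> ('k, 'sd, 'r, 'v, 'c) instr list" where
  "phase2 E p1 p2 n sel t = (let q = quart n; m1 = batch p1 n; m2 = batch p2 n in
     [get Arr_T1 (t * (q * m1)) (q * m1),
      decrypt_work E,
      distribute E n sel m2
        (map (\<lambda>b. (b * (q * m2) + (t mod q) * m2, bucket_start n b, bucket_start n (Suc b)))
           [t div q * q..<t div q * q + q]),
      put Arr_T2])"

definition cleanup :: "('k, 'sd, 'r, 'v, 'c) crypto \<Rightarrow> real \<Rightarrow> nat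
    \<Rightarrow> (('k, 'sd, 'v, 'c) client \<Rightarrow> 'sd option) \<Rightarrow> area \<Rightarrow> nat
    \<Rightarrow> ('k, 'sd, 'r, 'v, 'c) instr list" where
  "cleanup E p2 n sel dst b = (let q = quart n; m = batch p2 n in
     [get Arr_T2 (b * (q * m)) (q * m),
      decrypt_work E,
      Compute (\<lambda>w c. let \<rho> = prp E (the (sel c)) (total n) in
        c\<lparr>outbox := seal E (key c) (snd w)
            [(bucket_start n b,
              map (\<lambda>(x, v). Elem x v) (sort_key (\<lambda>(x, v). \<rho> x) (contents (work c))))]\<rparr>),
      put dst])"

definition pass :: "('k, 'sd, 'r, 'v, 'c) crypto \<Rightarrow> real \<Rightarrow> real \<Rightarrow> nat
    \<Rightarrow> (('k, 'sd, 'v, 'c) client \<Rightarrow> 'sd option) \<Rightarrow> area \<Rightarrow> area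
    \<Rightarrow> ('k, 'sd, 'r, 'v, 'c) instr list" where
  "pass E p1 p2 n sel src dst =
     [Op (\<lambda>_. Alloc Arr_T1 (quart n ^ 3 * batch p1 n)),
      Op (\<lambda>_. Alloc Arr_T2 (quart n ^ 3 * batch p2 n))]
     @ concat (map (phase1 E p1 n sel src) [0..<(quart n)\<^sup>2])
     @ concat (map (phase2 E p1 p2 n sel) [0..<(quart n)\<^sup>2])
     @ concat (map (cleanup E p2 n sel dst) [0..<(quart n)\<^sup>2])
     @ [Op (\<lambda>_. Free Arr_T1), Op (\<lambda>_. Free Arr_T2)]"

text \<open>\<open>shuffle(I, \<pi>, O)\<close>, where \<open>\<pi>\<close> is given by \<open>seed\<close>, followed by the assignment of \<open>O\<close> to \<open>I\<close>.
  The second pass can write to the array it reads from, because it has copied that array to \<open>T1\<close>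
  before its clean-up phase starts.\<close>

definition shuffle_I :: "('k, 'sd, 'r, 'v, 'c) crypto \<Rightarrow> real \<Rightarrow> real \<Rightarrow> nat
    \<Rightarrow> ('k, 'sd, 'r, 'v, 'c) instr list" where
  "shuffle_I E p1 p2 n =
     [Op (\<lambda>_. Alloc Arr_O (total n)), Compute (\<lambda>w c. c\<lparr>aux_seed := Some (fst w)\<rparr>)]
     @ pass E p1 p2 n aux_seed Arr_I Arr_O
     @ pass E p1 p2 n seed Arr_O Arr_O
     @ [Compute (\<lambda>_ c. c\<lparr>aux_seed := None\<rparr>), Op (\<lambda>_. Move Arr_O Arr_I)]"

definition pick_seed :: "('k, 'sd, 'r, 'v, 'c) instr" where
  "pick_seed = Compute (\<lambda>w c. c\<lparr>seed := Some (fst w)\<rparr>)"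

definition clear_cache :: "('k, 'sd, 'r, 'v, 'c) crypto \<Rightarrow> nat
    \<Rightarrow> ('k, 'sd, 'r, 'v, 'c) instr list" where
  "clear_cache E n =
     [Compute (\<lambda>w c. c\<lparr>outbox := seal E (key c) (snd w) [(0, replicate (fakes n) Dummy)]\<rparr>),
      put Arr_C]"

text \<open>\<open>D x\<close> is the initial value of item \<open>x\<close> for \<open>1 \<le> x \<le> n\<close>, and the (irrelevant) value of a fake
  element for \<open>x > n\<close>. The dataset to be outsourced is an input of the client that is read
  and uploaded bucket by bucket.\<close>

definition setup_prog :: "('k, 'sd, 'r, 'v, 'c) crypto \<Rightarrow> real \<Rightarrow> real \<Rightarrow> nat \<Rightarrow> (nat \<Rightarrow> 'v)
    \<Rightarrow> ('k, 'sd, 'r, 'v, 'c) instr list" where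
  "setup_prog E p1 p2 n D =
     [Op (\<lambda>_. Alloc Arr_I (total n))]
     @ concat (map (\<lambda>k.
         [Compute (\<lambda>_ c. c\<lparr>work := map (\<lambda>i. Elem (Suc i) (D (Suc i)))
                                     [bucket_start n k..<bucket_start n (Suc k)]\<rparr>),
          Compute (\<lambda>w c. c\<lparr>outbox := seal E (key c) (snd w) [(bucket_start n k, work c)]\<rparr>),
          put Arr_I]) [0..<(quart n)\<^sup>2])
     @ [pick_seed]
     @ shuffle_I E p1 p2 n
     @ [Op (\<lambda>_. Alloc Arr_C (fakes n))]
     @ clear_cache E n
     @ [wipe]"

text \<open>The key of the element of \<open>I\<close> that is read on a request for \<open>x\<close>. (When \<open>x\<close> is in the cache,
  the number of elements present is at least 1, so a fake element is read.)\<close>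

definition probe :: "nat \<Rightarrow> nat \<Rightarrow> 'v elem list \<Rightarrow> nat" where
  "probe n x es = (if lookup x es \<noteq> None then n + length (contents es) else x)"

definition access_prog :: "('k, 'sd, 'r, 'v, 'c) crypto \<Rightarrow> nat \<Rightarrow> 'v request
    \<Rightarrow> ('k, 'sd, 'r, 'v, 'c) instr list" where
  "access_prog E n rq =
     [Compute (\<lambda>_ c. c\<lparr>req := Some rq\<rparr>),
      get Arr_C 0 (fakes n),
      decrypt_cache E,
      Op (\<lambda>c. Get Arr_I [(prp E (the (seed c)) (total n)
                            (probe n (request_key (the (req c))) (cache c)) - 1, 1)]),
      decrypt_work E,
      Compute (\<lambda>w c.
        let x = request_key (the (req c));
            v = (case lookup x (cache c) of Some v \<Rightarrow> v | None \<Rightarrow> the (lookup x (work c)))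
        in (case the (req c) of
              Read _ \<Rightarrow> c\<lparr>answer := Some v,
                 outbox := seal E (key c) (snd w) [(length (contents (cache c)), [Elem x v])]\<rparr>
            | Write _ v' \<Rightarrow> c\<lparr>
                 outbox := seal E (key c) (snd w) [(length (contents (cache c)), [Elem x v'])]\<rparr>)),
      put Arr_C,
      wipe]"

primrec refresh :: "'v elem list \<Rightarrow> 'v elem \<Rightarrow> 'v elem" where
  "refresh es (Elem x v) = Elem x (case lookup x es of Some v' \<Rightarrow> v' | None \<Rightarrow> v)"
| "refresh es Dummy = Dummy"

text \<open>Here \<open>I\<close> is split into buckets of size \<open>\<surd>n\<close>, the last of which may be shorter.\<close>

definition rebuild_prog :: "('k, 'sd, 'r, 'v, 'c) crypto \<Rightarrow> real \<Rightarrow> real \<Rightarrow> nat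
    \<Rightarrow> ('k, 'sd, 'r, 'v, 'c) instr list" where
  "rebuild_prog E p1 p2 n = (let s = fakes n in
     [get Arr_C 0 s, decrypt_cache E]
     @ concat (map (\<lambda>k.
         [get Arr_I (k * s) (min s (total n - k * s)),
          decrypt_work E,
          Compute (\<lambda>w c. c\<lparr>outbox :=
            seal E (key c) (snd w) [(k * s, map (refresh (cache c)) (work c))]\<rparr>),
          put Arr_I]) [0..<nat \<lceil>real (total n) / real s\<rceil>])
     @ [Compute (\<lambda>_ c. c\<lparr>cache := []\<rparr>), pick_seed]
     @ shuffle_I E p1 p2 n
     @ clear_cache E n
     @ [wipe])"

definition requests_prog :: "('k, 'sd, 'r, 'v, 'c) crypto \<Rightarrow> real \<Rightarrow> real \<Rightarrow> nat \<Rightarrow> 'v request list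
    \<Rightarrow> ('k, 'sd, 'r, 'v, 'c) instr list" where
  "requests_prog E p1 p2 n reqs =
     concat (map (\<lambda>i. access_prog E n (reqs ! i)
                    @ (if fakes n dvd Suc i then rebuild_prog E p1 p2 n else []))
       [0..<length reqs])"

definition initial_config :: "'k \<Rightarrow> ('k, 'sd, 'v, 'c) config" where
  "initial_config k = (\<lparr>key = k, seed = None, aux_seed = None, req = None, answer = None,
     cache = [], work = [], inbox = [], outbox = []\<rparr>, \<lambda>_. [])"

definition scheme_trace :: "('k, 'sd, 'r, 'v, 'c) crypto \<Rightarrow> real \<Rightarrow> real \<Rightarrow> nat \<Rightarrow> 'k \<Rightarrow> (nat \<Rightarrow> 'v)
    \<Rightarrow> (nat \<Rightarrow> ('sd, 'r) coins) \<Rightarrow> 'v request list \<Rightarrow> ('k, 'sd, 'v, 'c) event list" where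
  "scheme_trace E p1 p2 n k D \<omega> reqs =
     exec \<omega> 0 (setup_prog E p1 p2 n D @ requests_prog E p1 p2 n reqs) (initial_config k)"

text \<open>Number of server operations executed after the setup, divided by the number of requests.\<close>

definition access_overhead :: "('k, 'sd, 'r, 'v, 'c) crypto \<Rightarrow> real \<Rightarrow> real \<Rightarrow> nat \<Rightarrow> 'k
    \<Rightarrow> (nat \<Rightarrow> 'v) \<Rightarrow> (nat \<Rightarrow> ('sd, 'r) coins) \<Rightarrow> 'v request list \<Rightarrow> real" where
  "access_overhead E p1 p2 n k D \<omega> reqs =
     real (length (filter (\<lambda>(opn, s). opn \<noteq> None)
       (drop (length (setup_prog E p1 p2 n D)) (scheme_trace E p1 p2 n k D \<omega> reqs))))
     / real (length reqs)"

end

theory Submission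
  imports Defs
begin

text \<open>No correctness of the shuffle is needed: every instruction, taken by itself, keeps each buffer of
  the client below \<open>O((quart n)\<^sup>2)\<close> elements and each server area below its allotted size, whatever
  the earlier instructions have stored there. The overhead follows by counting the operations
  of the program: a rebuild has \<open>O(\<surd>n)\<close> of them and happens once in \<open>fakes n \<ge> \<surd>n\<close> requests.\<close>

section \<open>Sizes of outboxes and of overwritten arrays\<close>

text \<open>This sum occurs both in \<open>private_size\<close>, for the outbox, and in the
  \<open>message_size\<close> of a \<open>Put\<close>, so one bound serves both.\<close>

definition payload :: "(nat \<times> 'a list) list \<Rightarrow> nat" where
  "payload ws = (\<Sum>(i, ys)\<leftarrow>ws. length ys)"

lemma payload_simps [simp]:
  "payload [] = 0"
  "payload ((i, ys) # ws) = length ys + payload ws"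
  by (simp_all add: payload_def)

lemma payload_seal [simp]: "payload (seal E k r ws) = payload ws"
proof -
  have "payload (seal E k r ws) = (\<Sum>j\<leftarrow>[0..<length ws]. length (snd (ws ! j)))"
    by (simp add: payload_def seal_def o_def)
  also have "\<dots> = (\<Sum>w\<leftarrow>map ((!) ws) [0..<length ws]. length (snd w))"
    by (simp only: map_map o_def)
  finally show ?thesis
    by (simp add: map_nth payload_def case_prod_unfold)
qed

lemma payload_const:
  assumes "\<And>i ys. (i, ys) \<in> set ws \<Longrightarrow> length ys = m"
  shows "payload ws = length ws * m"
  using assms
proof (induction ws)
  case (Cons w ws)
  then have "length (snd w) = m" "payload ws = length ws * m"
    by (metis list.set_intros(1) prod.collapse, metis list.set_intros(2))
  then show ?case
    by (simp add: payload_def case_prod_unfold)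
qed simp

lemma length_contents_le: "length (contents es) \<le> length es"
  by (induction es) (auto simp: contents_def split: elem.splits)

text \<open>\<open>overwrite\<close> maps over the indices of the old array and drops whatever falls
  outside, so a \<open>Put\<close> never enlarges an area, whatever its offsets.\<close>

lemma length_fold_overwrite [simp]: "length (fold overwrite ws xs) = length xs"
  by (induction ws arbitrary: xs) (auto simp: overwrite_def)

section \<open>The size invariant along an execution\<close>

text \<open>Each buffer has its own bound, so an instruction that replaces one buffer is checked for
  that buffer only. The key and the four optional fields are left out; they add at most 5 to
  \<open>private_size\<close>.\<close>

definition bounded_client :: "nat \<Rightarrow> ('k, 'sd, 'v, 'c) client \<Rightarrow> bool" where
  "bounded_client B c \<longleftrightarrow> length (cache c) \<le> B \<and> length (work c) \<le> B \<and>
     length (inbox c) \<le> B \<and> payload (outbox c) \<le> B"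

definition bounded_server :: "(area \<Rightarrow> nat) \<Rightarrow> 'c server \<Rightarrow> bool" where
  "bounded_server S \<sigma> \<longleftrightarrow> (\<forall>a. length (\<sigma> a) \<le> S a)"

definition bounded_event :: "nat \<Rightarrow> (area \<Rightarrow> nat) \<Rightarrow> ('k, 'sd, 'v, 'c) event \<Rightarrow> bool" where
  "bounded_event B S = (\<lambda>(opn, c, \<sigma>). bounded_client B c \<and> bounded_server S \<sigma> \<and>
     (\<forall>m. opn = Some m \<longrightarrow> message_size m \<le> B))"

text \<open>Preservation is asked from every bounded configuration and for all coins, so a program
  can be checked one instruction at a time.\<close>

definition tame :: "nat \<Rightarrow> (area \<Rightarrow> nat) \<Rightarrow> ('k, 'sd, 'r, 'v, 'c) instr \<Rightarrow> bool" where
  "tame B S i \<longleftrightarrow> (\<forall>w c \<sigma> e. bounded_client B c \<longrightarrow> bounded_server S \<sigma> \<longrightarrow>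
     step w i (c, \<sigma>) = Some e \<longrightarrow> bounded_event B S e)"

lemma bounded_event_exec:
  assumes "\<forall>i \<in> set is. tame B S i" "bounded_client B (fst s)" "bounded_server S (snd s)"
  shows "\<forall>e \<in> set (exec \<omega> t is s). bounded_event B S e"
  using assms
proof (induction "is" arbitrary: t s)
  case (Cons i "is")
  show ?case
  proof (cases "step (\<omega> t) i s")
    case (Some e)
    then have e: "bounded_event B S e"
      using Cons.prems unfolding tame_def by (metis list.set_intros(1) prod.collapse)
    then have "bounded_client B (fst (snd e))" "bounded_server S (snd (snd e))"
      by (auto simp: bounded_event_def)
    then show ?thesis
      using Cons e Some by simp
  qed simp
qed simp

lemma private_size_le:
  assumes "bounded_client B c"
  shows "private_size c \<le> 5 + 4 * B"
proof -
  have "card (set_option z) \<le> 1" for z :: "'z option"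
    by (cases z) auto
  from this[of "seed c"] this[of "aux_seed c"] this[of "req c"] this[of "answer c"]
  show ?thesis
    using assms by (simp add: private_size_def bounded_client_def payload_def)
qed

section \<open>Tameness of the single instructions\<close>

lemma tame_Local:
  assumes "\<And>w c c'. bounded_client B c \<Longrightarrow> f w c = Some c' \<Longrightarrow> bounded_client B c'"
  shows "tame B S (Local f)"
  using assms by (fastforce simp: tame_def bounded_event_def split: option.splits)

lemma tame_Compute:
  assumes "\<And>w c. bounded_client B c \<Longrightarrow> bounded_client B (f w c)"
  shows "tame B S (Compute f)"
  unfolding Compute_def using assms by (intro tame_Local) auto

text \<open>Ranges are cut off at the end of the area, hence an inequality. The requested lengths
  thus bound the response in the inbox as well as the message.\<close>

lemma length_concat_ranges:
  "length (concat (map (\<lambda>(i, l). take l (drop i xs)) rs)) \<le> (\<Sum>(i, l)\<leftarrow>rs. l)"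
  by (induction rs) (auto intro!: add_mono)

lemma tame_Op_Get:
  assumes "\<And>c. (\<Sum>(i, l)\<leftarrow>rs c. l) \<le> B"
  shows "tame B S (Op (\<lambda>c. Get a (rs c)))"
  using assms length_concat_ranges
  by (auto simp: tame_def bounded_event_def bounded_client_def intro: order_trans)

lemma tame_get: "l \<le> B \<Longrightarrow> tame B S (get a i l)"
  unfolding get_def by (rule tame_Op_Get) simp

text \<open>The message is the current outbox, which the invariant already bounds; afterwards inbox
  and outbox are empty.\<close>

lemma tame_put [simp]: "tame B S (put a)"
  by (auto simp: tame_def bounded_event_def bounded_client_def bounded_server_def put_def
      payload_def)

lemma tame_Alloc: "m \<le> S a \<Longrightarrow> tame B S (Op (\<lambda>_. Alloc a m))"
  by (auto simp: tame_def bounded_event_def bounded_client_def bounded_server_def)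

lemma tame_Free [simp]: "tame B S (Op (\<lambda>_. Free a))"
  by (auto simp: tame_def bounded_event_def bounded_client_def bounded_server_def)

lemma tame_Move: "S a \<le> S b \<Longrightarrow> tame B S (Op (\<lambda>_. Move a b))"
  by (auto simp: tame_def bounded_event_def bounded_client_def bounded_server_def
      intro: order_trans)

lemma tame_decrypt [simp]: "tame B S (decrypt_work E)" "tame B S (decrypt_cache E)"
  unfolding decrypt_work_def decrypt_cache_def
  by (auto intro!: tame_Compute simp: bounded_client_def)

lemma tame_wipe [simp]: "tame B S wipe"
  unfolding wipe_def by (auto intro!: tame_Compute simp: bounded_client_def)

lemma tame_pick_seed [simp]: "tame B S pick_seed"
  unfolding pick_seed_def by (auto intro!: tame_Compute simp: bounded_client_def)

lemma tame_distribute: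
  assumes "length ts * m \<le> B"
  shows "tame B S (distribute E n sel m ts)"
  unfolding distribute_def
proof (rule tame_Local)
  fix w c c'
  define bs where "bs = map (\<lambda>(a, lo, hi).
    (a, filter (targeted (prp E (the (sel c)) (total n)) lo hi) (work c))) ts"
  define ws where "ws = map (\<lambda>(a, es). (a, es @ replicate (m - length es) Dummy)) bs"
  assume c: "bounded_client B c" and "(let \<rho> = prp E (the (sel c)) (total n);
         bs = map (\<lambda>(a, lo, hi). (a, filter (targeted \<rho> lo hi) (work c))) ts
     in if \<exists>(a, es) \<in> set bs. length es > m then None
        else Some (c\<lparr>outbox := seal E (key c) (snd w)
               (map (\<lambda>(a, es). (a, es @ replicate (m - length es) Dummy)) bs)\<rparr>)) = Some c'"
  then have fit: "\<not> (\<exists>(a, es) \<in> set bs. length es > m)"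
    and c': "c' = c\<lparr>outbox := seal E (key c) (snd w) ws\<rparr>"
    unfolding Let_def bs_def[symmetric] ws_def[symmetric] by (auto split: if_splits)
  \<comment> \<open>Passing the failure test gives \<open>length es \<le> m\<close>, so the
    truncated subtraction in the padding is exact and every batch has length
    \<open>m\<close>.\<close>
  have "payload ws = length ws * m"
    by (rule payload_const) (use fit in \<open>fastforce simp: ws_def\<close>)
  with assms have "payload ws \<le> B"
    by (simp add: ws_def bs_def)
  with c show "bounded_client B c'"
    by (simp add: c' bounded_client_def)
qed

section \<open>Size budgets for buffers, messages and server areas\<close>

text \<open>The product covers \<open>quart n\<close> batches of either kind, which is also one
  bucket of \<open>T1\<close> or \<open>T2\<close>; the rest covers a bucket of the shuffled array,
  the cache, a rebuild bucket and a single element.\<close>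

definition room :: "real \<Rightarrow> real \<Rightarrow> nat \<Rightarrow> nat" where
  "room p1 p2 n = quart n * (batch p1 n + batch p2 n) + (quart n)\<^sup>2 + 1"

text \<open>\<open>T1\<close> and \<open>T2\<close> consist of \<open>(quart n)\<^sup>2\<close>
  buckets of \<open>quart n\<close> batches each. \<open>I\<close> and \<open>O\<close> have equal
  capacities, which suits the final \<open>Move\<close> of a shuffle.\<close>

primrec capacity :: "real \<Rightarrow> real \<Rightarrow> nat \<Rightarrow> area \<Rightarrow> nat" where
  "capacity p1 p2 n Arr_I = total n"
| "capacity p1 p2 n Arr_O = total n"
| "capacity p1 p2 n Arr_T1 = quart n ^ 3 * batch p1 n"
| "capacity p1 p2 n Arr_T2 = quart n ^ 3 * batch p2 n"
| "capacity p1 p2 n Arr_C = fakes n"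

lemma UNIV_area: "UNIV = {Arr_I, Arr_O, Arr_T1, Arr_T2, Arr_C}"
  using area.exhaust by blast

lemma server_size_le:
  assumes "bounded_server (capacity p1 p2 n) \<sigma>"
  shows "server_size \<sigma> \<le> 2 * total n + fakes n + quart n ^ 3 * (batch p1 n + batch p2 n)"
proof -
  have "server_size \<sigma> \<le> (\<Sum>a\<in>UNIV. capacity p1 p2 n a)"
    unfolding server_size_def using assms by (intro sum_mono) (simp add: bounded_server_def)
  also have "\<dots> = 2 * total n + fakes n + quart n ^ 3 * (batch p1 n + batch p2 n)"
    by (simp add: UNIV_area algebra_simps)
  finally show ?thesis .
qed

section \<open>Rounded roots and bucket sizes\<close>

lemma total_le_quart: "total n \<le> quart n ^ 4"
proof -
  have "real (total n) = root 4 (real (total n)) ^ 4"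
    by simp
  also have "\<dots> \<le> real (quart n) ^ 4"
    unfolding quart_def by (intro power_mono) (auto simp: of_nat_ceiling)
  finally show ?thesis
    by (metis of_nat_le_iff of_nat_power)
qed

text \<open>\<open>n \<le> total n \<le> quart n ^ 4\<close> puts \<open>sqrt n\<close> below the
  integer \<open>(quart n)\<^sup>2\<close>, hence its ceiling too.\<close>

lemma fakes_le_quart: "fakes n \<le> (quart n)\<^sup>2"
proof -
  have "real n \<le> real (quart n ^ 4)"
    using total_le_quart[of n] by (simp only: of_nat_le_iff) (simp add: total_def)
  then have "sqrt (real n) \<le> real ((quart n)\<^sup>2)"
    by (intro real_le_lsqrt) (simp_all flip: power_mult)
  then show ?thesis
    unfolding fakes_def by (simp only: nat_ceiling_le_eq)
qed

text \<open>With \<open>d = (quart n)\<^sup>2\<close>, boundaries are floors of multiples of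
  \<open>total n / d\<close>; consecutive ones differ by at most \<open>total n div d\<close> plus a
  carry of 1, and \<open>total n \<le> d\<^sup>2\<close>.\<close>

lemma bucket_size_le: "bucket_size n k \<le> (quart n)\<^sup>2 + 1"
proof (cases "quart n = 0")
  case False
  define d where "d = (quart n)\<^sup>2"
  have d: "d > 0"
    using False by (simp add: d_def)
  have N: "total n div d \<le> d"
    using total_le_quart[of n] d
    by (metis d_def div_le_mono mult_2 nonzero_mult_div_cancel_left not_less_zero
        numeral_Bit0 power2_eq_square power_add)
  \<comment> \<open>Two remainders modulo \<open>d\<close> sum to less than \<open>2 * d\<close>;
    their quotient by \<open>d\<close> is the carry in \<open>div_add1_eq\<close>.\<close>
  have "(k * total n mod d + total n mod d) div d \<le> 1"
    using d by (intro less_Suc_eq_le[THEN iffD1])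
      (simp add: div_less_iff_less_mult add_strict_mono)
  then have "(k * total n + total n) div d \<le> k * total n div d + total n div d + 1"
    by (subst div_add1_eq) simp
  then show ?thesis
    using N by (simp add: bucket_size_def bucket_start_def add.commute flip: d_def)
\<comment> \<open>Division by 0 yields 0, so for \<open>quart n = 0\<close> all boundaries
  coincide.\<close>
qed (simp add: bucket_size_def bucket_start_def)

section \<open>Tameness of the programs of the scheme\<close>

context
  fixes p1 p2 :: real and n :: nat
begin

abbreviation tame_n :: "('k, 'sd, 'r, 'v, 'c) instr \<Rightarrow> bool" where
  "tame_n \<equiv> tame (room p1 p2 n) (capacity p1 p2 n)"

lemma room_ge:
  "quart n * batch p1 n \<le> room p1 p2 n" "quart n * batch p2 n \<le> room p1 p2 n"
  "bucket_size n k \<le> room p1 p2 n" "fakes n \<le> room p1 p2 n" "1 \<le> room p1 p2 n"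
  using bucket_size_le[of n k] fakes_le_quart[of n] by (auto simp: room_def algebra_simps)

lemma tame_phase1: "i \<in> set (phase1 E p1 n sel src k) \<Longrightarrow> tame_n i"
  using room_ge by (auto simp: phase1_def Let_def intro!: tame_get tame_distribute)

lemma tame_phase2: "i \<in> set (phase2 E p1 p2 n sel t) \<Longrightarrow> tame_n i"
  using room_ge by (auto simp: phase2_def Let_def intro!: tame_get tame_distribute)

text \<open>The list written back is made from the \<open>contents\<close> of \<open>work\<close>,
  so it is no longer than \<open>work\<close>, which the invariant bounds.\<close>

lemma tame_cleanup: "i \<in> set (cleanup E p2 n sel dst b) \<Longrightarrow> tame_n i"
  using room_ge
  by (auto simp: cleanup_def Let_def bounded_client_def intro!: tame_get tame_Compute
      intro: order_trans[OF length_contents_le])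

lemma tame_pass: "i \<in> set (pass E p1 p2 n sel src dst) \<Longrightarrow> tame_n i"
  by (auto simp: pass_def intro: tame_Alloc tame_phase1 tame_phase2 tame_cleanup)

lemma tame_shuffle_I: "i \<in> set (shuffle_I E p1 p2 n) \<Longrightarrow> tame_n i"
  by (auto simp: shuffle_I_def bounded_client_def
      intro!: tame_Alloc tame_Move tame_Compute intro: tame_pass)

lemma tame_clear_cache: "i \<in> set (clear_cache E n) \<Longrightarrow> tame_n i"
  using room_ge by (auto simp: clear_cache_def bounded_client_def intro!: tame_Compute)

lemma tame_setup_prog: "i \<in> set (setup_prog E p1 p2 n D) \<Longrightarrow> tame_n i"
  using room_ge
  by (auto simp: setup_prog_def bounded_client_def bucket_size_def
      simp del: upt_Suc intro!: tame_Alloc tame_Compute intro: tame_shuffle_I tame_clear_cache)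

lemma tame_access_prog: "i \<in> set (access_prog E n rq) \<Longrightarrow> tame_n i"
  using room_ge
  by (auto simp: access_prog_def bounded_client_def Let_def
      intro!: tame_Compute tame_get tame_Op_Get split: request.splits)

lemma tame_rebuild_prog: "i \<in> set (rebuild_prog E p1 p2 n) \<Longrightarrow> tame_n i"
  using room_ge
  by (auto simp: rebuild_prog_def bounded_client_def Let_def
      intro!: tame_Compute tame_get
      intro: tame_shuffle_I tame_clear_cache min.coboundedI1)

lemma tame_requests_prog: "i \<in> set (requests_prog E p1 p2 n reqs) \<Longrightarrow> tame_n i"
  by (auto simp: requests_prog_def split: if_splits intro: tame_access_prog tame_rebuild_prog)

lemma bounded_scheme_trace:
  "\<forall>e \<in> set (scheme_trace E p1 p2 n k D \<omega> reqs).
     bounded_event (room p1 p2 n) (capacity p1 p2 n) e"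
  unfolding scheme_trace_def
  by (intro bounded_event_exec)
    (auto simp: initial_config_def bounded_client_def bounded_server_def
      intro: tame_setup_prog tame_requests_prog)

end

section \<open>Counting server operations\<close>

primrec is_op :: "('k, 'sd, 'r, 'v, 'c) instr \<Rightarrow> bool" where
  "is_op (Local f) = False"
| "is_op (Op g) = True"

definition op_count :: "('k, 'sd, 'r, 'v, 'c) instr list \<Rightarrow> nat" where
  "op_count is = length (filter is_op is)"

lemma op_count_simps [simp]:
  "op_count [] = 0"
  "op_count (Compute f # is) = op_count is"
  "op_count (Op g # is) = Suc (op_count is)"
  "op_count (get a j l # is) = Suc (op_count is)"
  "op_count (put a # is) = Suc (op_count is)"
  "op_count (decrypt_work E # is) = op_count is"
  "op_count (decrypt_cache E # is) = op_count is"
  "op_count (wipe # is) = op_count is"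
  "op_count (pick_seed # is) = op_count is"
  "op_count (distribute E n sel m ts # is) = op_count is"
  "op_count (is @ js) = op_count is + op_count js"
  by (simp_all add: op_count_def Compute_def get_def put_def decrypt_work_def decrypt_cache_def
      wipe_def pick_seed_def distribute_def)

lemma op_count_concat_const:
  assumes "\<And>x. op_count (f x) = m"
  shows "op_count (concat (map f xs)) = length xs * m"
  using assms by (induction xs) auto

text \<open>Each executed instruction yields one event, with an operation exactly if it is an
  \<open>Op\<close>; a failure can only cut the count short.\<close>

lemma ops_exec_le_op_count:
  "length (filter (\<lambda>(opn, s). opn \<noteq> None) (exec \<omega> t is s)) \<le> op_count is"
proof (induction "is" arbitrary: t s)
  case (Cons i "is")
  show ?case
  proof (cases i)
    case (Local f)
    then show ?thesis
      using Cons by (auto simp: op_count_def split: option.splits)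
  next
    case (Op g)
    then show ?thesis
      using Cons by (auto simp: op_count_def Let_def split: option.splits prod.splits)
  qed
qed simp

text \<open>If \<open>is\<close> fails, the trace is shorter than \<open>is\<close> and nothing
  remains. Otherwise \<open>is\<close> contributes exactly one event per instruction, and what
  remains is an execution of \<open>js\<close>.\<close>

lemma drop_exec_append:
  "drop (length is) (exec \<omega> t (is @ js) s) = [] \<or>
   (\<exists>t' s'. drop (length is) (exec \<omega> t (is @ js) s) = exec \<omega> t' js s')"
  by (induction "is" arbitrary: t s) (auto split: option.splits)

lemma op_count_pass: "op_count (pass E p1 p2 n sel src dst) = 6 * (quart n)\<^sup>2 + 4"
proof -
  have "op_count (phase1 E p1 n sel src k) = 2" "op_count (phase2 E p1 p2 n sel k) = 2"
    "op_count (cleanup E p2 n sel dst k) = 2" for k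
    by (simp_all add: phase1_def phase2_def cleanup_def Let_def)
  then show ?thesis
    by (simp add: pass_def op_count_concat_const)
qed

text \<open>The constant 12 collects reading the cache, allocating and moving \<open>O\<close>, four
  control operations in each of the two passes, and clearing the cache.\<close>

lemma op_count_rebuild_prog: "op_count (rebuild_prog E p1 p2 n) =
    2 * nat \<lceil>real (total n) / real (fakes n)\<rceil> + 12 * (quart n)\<^sup>2 + 12"
  by (simp add: rebuild_prog_def shuffle_I_def clear_cache_def op_count_pass Let_def
      op_count_concat_const[where m = 2])

lemma op_count_access_prog: "op_count (access_prog E n rq) = 3"
  by (simp add: access_prog_def)

text \<open>Rebuilds happen at the multiples of \<open>fakes n\<close>; \<open>div_Suc\<close> says
  that the quotient grows exactly there.\<close>

lemma op_count_requests_prog: "op_count (requests_prog E p1 p2 n reqs) =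
    3 * length reqs + length reqs div fakes n * op_count (rebuild_prog E p1 p2 n)"
proof -
  have "op_count (concat (map (\<lambda>i. access_prog E n (reqs ! i)
          @ (if fakes n dvd Suc i then rebuild_prog E p1 p2 n else [])) [0..<m]))
      = 3 * m + m div fakes n * op_count (rebuild_prog E p1 p2 n)" for m
    by (induction m) (auto simp: op_count_access_prog div_Suc dvd_eq_mod_eq_0 algebra_simps)
  then show ?thesis
    by (simp add: requests_prog_def)
qed

section \<open>Estimates in terms of \<open>n\<close>, with rounding errors absorbed by
  \<open>sqrt n \<ge> 1\<close>\<close>

context
  fixes n :: nat
  assumes n: "n \<ge> 1"
begin

lemma sqrt_ge_1: "1 \<le> sqrt (real n)"
  using n by simp

lemma sqrt_le_self: "sqrt (real n) \<le> real n"
  using sqrt_ge_1 mult_left_mono[of 1 "sqrt (real n)" "sqrt (real n)"] by simp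

lemma fakes_ge: "sqrt (real n) \<le> real (fakes n)"
  by (simp add: fakes_def of_nat_ceiling)

lemma fakes_le: "real (fakes n) \<le> 2 * real n"
proof -
  have "real (fakes n) < sqrt (real n) + 1"
    unfolding fakes_def using sqrt_ge_1 by linarith
  then show ?thesis
    using sqrt_ge_1 sqrt_le_self by linarith
qed

lemma total_le: "real (total n) \<le> 3 * real n"
  using fakes_le by (simp add: total_def)

lemma quart_ge_1: "1 \<le> quart n"
  using total_le_quart[of n] n by (cases "quart n") (auto simp: total_def)

text \<open>For the unrounded root \<open>r\<close>, rounding gives
  \<open>quart n \<le> r + 1 \<le> 2 * r\<close>, a factor 4 after squaring. The other factor 2
  comes from \<open>r ^ 4 = total n \<le> 3 * n \<le> 4 * n\<close>.\<close>

lemma quart_sq_le: "real (quart n) ^ 2 \<le> 8 * sqrt (real n)"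
proof -
  define r where "r = root 4 (real (total n))"
  have r: "1 \<le> r"
    using n by (simp add: r_def total_def)
  have "real (quart n) \<le> 2 * r"
    using r unfolding quart_def r_def[symmetric] by linarith
  then have "real (quart n) ^ 2 \<le> (2 * r) ^ 2"
    by (rule power_mono) simp
  moreover have "r ^ 2 \<le> 2 * sqrt (real n)"
  proof (rule power2_le_imp_le)
    have "(r ^ 2) ^ 2 = real (total n)"
      by (simp add: r_def flip: power_mult)
    then show "(r ^ 2) ^ 2 \<le> (2 * sqrt (real n)) ^ 2"
      using total_le by (simp add: power_mult_distrib)
  qed simp
  ultimately show ?thesis
    by (simp add: power_mult_distrib)
qed

lemma batch_le:
  assumes "p > 0"
  shows "real (batch p n) \<le> (p + 1) * real (quart n)"
proof -
  have "0 \<le> p * real (quart n)"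
    using assms by simp
  then have "real (batch p n) \<le> p * real (quart n) + 1"
    unfolding batch_def by linarith
  then show ?thesis
    using quart_ge_1 by (simp add: algebra_simps)
qed

lemma batches_le:
  assumes "p1 > 0" "p2 > 0"
  shows "real (batch p1 n + batch p2 n) \<le> (p1 + p2 + 2) * real (quart n)"
  using batch_le[of p1] batch_le[of p2] assms by (simp add: algebra_simps)

text \<open>The batches contribute \<open>p1 + p2 + 2\<close> times
  \<open>(quart n)\<^sup>2\<close>, and \<open>(quart n)\<^sup>2 + 1\<close> at most two more; the
  factor 8 is that of \<open>quart_sq_le\<close>.\<close>

lemma room_le:
  assumes "p1 > 0" "p2 > 0"
  shows "real (room p1 p2 n) \<le> 8 * (p1 + p2 + 4) * sqrt (real n)"
proof -
  let ?q = "real (quart n)"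
  have "1 \<le> ?q ^ 2"
    using quart_ge_1 by simp
  moreover have "?q * real (batch p1 n + batch p2 n) \<le> ?q * ((p1 + p2 + 2) * ?q)"
    using batches_le[OF assms] by (intro mult_left_mono) auto
  ultimately have "real (room p1 p2 n) \<le> (p1 + p2 + 4) * ?q ^ 2"
    by (simp add: room_def algebra_simps power2_eq_square)
  also have "\<dots> \<le> (p1 + p2 + 4) * (8 * sqrt (real n))"
    using quart_sq_le assms by (intro mult_left_mono) auto
  finally show ?thesis
    by (simp add: algebra_simps)
qed

text \<open>\<open>T1\<close> and \<open>T2\<close> together take a multiple of
  \<open>quart n ^ 4\<close>, at most \<open>64 * n\<close> by squaring \<open>quart_sq_le\<close>.
  The 8 is twice 3 for \<open>I\<close> and \<open>O\<close> plus 2 for the cache.\<close>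

lemma server_le:
  assumes "p1 > 0" "p2 > 0"
  shows "real (2 * total n + fakes n + quart n ^ 3 * (batch p1 n + batch p2 n))
    \<le> (8 + 64 * (p1 + p2 + 2)) * real n"
proof -
  let ?q = "real (quart n)"
  have "?q ^ 3 * real (batch p1 n + batch p2 n) \<le> ?q ^ 3 * ((p1 + p2 + 2) * ?q)"
    using batches_le[OF assms] by (intro mult_left_mono) auto
  also have "\<dots> = (p1 + p2 + 2) * (?q ^ 2) ^ 2"
    by (simp add: power2_eq_square power3_eq_cube)
  also have "\<dots> \<le> (p1 + p2 + 2) * (8 * sqrt (real n)) ^ 2"
    using quart_sq_le assms by (intro mult_left_mono power_mono) auto
  finally show ?thesis
    using total_le fakes_le by (simp add: power_mult_distrib algebra_simps)
qed

text \<open>With \<open>s = sqrt n\<close> the count is at most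
  \<open>2 * (3 * s + 1) + 12 * 8 * s + 12 \<le> 116 * s\<close>. It is stated relative to
  \<open>fakes n\<close>, the rebuild period, for the amortization.\<close>

lemma op_count_rebuild_prog_le:
  "real (op_count (rebuild_prog E p1 p2 n)) \<le> 116 * real (fakes n)"
proof -
  have "real (total n) / real (fakes n) \<le> 3 * real n / sqrt (real n)"
    using total_le fakes_ge n by (intro frac_le) auto
  also have "\<dots> = 3 * sqrt (real n)"
    by (simp add: real_div_sqrt flip: times_divide_eq_right)
  finally have "real (nat \<lceil>real (total n) / real (fakes n)\<rceil>) \<le> 3 * sqrt (real n) + 1"
    using sqrt_ge_1 by linarith
  then have "real (op_count (rebuild_prog E p1 p2 n)) \<le> 116 * sqrt (real n)"
    using quart_sq_le sqrt_ge_1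
    unfolding op_count_rebuild_prog of_nat_add of_nat_mult of_nat_power of_nat_numeral
    by linarith
  then show ?thesis
    using fakes_ge by simp
qed

text \<open>Every rebuild is charged to the \<open>fakes n\<close> requests preceding it, 116
  operations each; an access itself takes 3. An incomplete last period costs no rebuild.\<close>

lemma op_count_requests_prog_le:
  "real (op_count (requests_prog E p1 p2 n reqs)) \<le> 119 * real (length reqs)"
proof -
  let ?k = "length reqs div fakes n"
  have "real ?k * real (op_count (rebuild_prog E p1 p2 n)) \<le> real ?k * (116 * real (fakes n))"
    using op_count_rebuild_prog_le by (intro mult_left_mono) auto
  also have "\<dots> = 116 * real (?k * fakes n)"
    by simp
  also have "\<dots> \<le> 116 * real (length reqs)"
    by (simp only: mult_le_cancel_left_pos of_nat_le_iff zero_less_numeral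
        div_times_less_eq_dividend)
  finally show ?thesis
    by (simp add: op_count_requests_prog)
qed

lemma access_overhead_le:
  assumes "reqs \<noteq> []"
  shows "access_overhead E p1 p2 n k D \<omega> reqs \<le> 119"
proof -
  let ?post = "drop (length (setup_prog E p1 p2 n D)) (scheme_trace E p1 p2 n k D \<omega> reqs)"
  have "length (filter (\<lambda>(opn, s). opn \<noteq> None) ?post)
      \<le> op_count (requests_prog E p1 p2 n reqs)"
    unfolding scheme_trace_def
    using drop_exec_append[of "setup_prog E p1 p2 n D" \<omega> 0 "requests_prog E p1 p2 n reqs"
        "initial_config k"] ops_exec_le_op_count
    by (metis filter.simps(1) le0 list.size(3))
  then have "real (length (filter (\<lambda>(opn, s). opn \<noteq> None) ?post)) \<le> 119 * real (length reqs)"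
    using op_count_requests_prog_le[of E p1 p2 reqs] by linarith
  then show ?thesis
    using assms by (simp add: access_overhead_def divide_le_eq)
qed

end

section \<open>The asymptotic bounds\<close>

text \<open>The four bounds are chosen before \<open>n\<close>, the cryptography, the data, the
  coins and the requests, so their constants depend on \<open>p1\<close> and \<open>p2\<close>
  alone. The size bounds hold at every event, also in runs cut short by a failing shuffle.\<close>

theorem theorem7p2:
  fixes p1 p2 :: real
  assumes "p1 > 1" and "p2 > 1"
  shows "\<exists>priv msg srv ovh :: nat \<Rightarrow> real.
    priv \<in> O(\<lambda>n. sqrt (real n)) \<and> msg \<in> O(\<lambda>n. sqrt (real n)) \<and>
    srv \<in> O(\<lambda>n. real n) \<and> ovh \<in> O(\<lambda>n. 1) \<and>
    (\<forall>n \<ge> 1. \<forall>(E :: ('k, 'sd, 'r, 'v, 'c) crypto) k D \<omega> reqs.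
       valid_crypto E \<longrightarrow> valid_requests n reqs \<longrightarrow>
         (\<forall>(opn, c, \<sigma>) \<in> set (scheme_trace E p1 p2 n k D \<omega> reqs).
            real (private_size c) \<le> priv n \<and>
            (\<forall>m. opn = Some m \<longrightarrow> real (message_size m) \<le> msg n) \<and>
            real (server_size \<sigma>) \<le> srv n) \<and>
         (reqs \<noteq> [] \<longrightarrow> access_overhead E p1 p2 n k D \<omega> reqs \<le> ovh n))"
proof -
  define b where "b = 8 * (p1 + p2 + 4)"
  have pos: "p1 > 0" "p2 > 0"
    using assms by auto
  have size: "real (private_size c) \<le> (5 + 4 * b) * sqrt (real n) \<and>
      (\<forall>m. opn = Some m \<longrightarrow> real (message_size m) \<le> b * sqrt (real n)) \<and>
      real (server_size \<sigma>) \<le> (8 + 64 * (p1 + p2 + 2)) * real n"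
    if n: "n \<ge> 1" and ev: "(opn, c, \<sigma>) \<in> set (scheme_trace E p1 p2 n k D \<omega> reqs)"
    for n opn c \<sigma> k D \<omega> reqs and E :: "('k, 'sd, 'r, 'v, 'c) crypto"
  proof (intro conjI allI impI)
    have B: "bounded_event (room p1 p2 n) (capacity p1 p2 n) (opn, c, \<sigma>)"
      by (rule bspec[OF bounded_scheme_trace ev])
    have room: "real (room p1 p2 n) \<le> b * sqrt (real n)"
      using room_le[OF n pos] by (simp add: b_def)
    have "private_size c \<le> 5 + 4 * room p1 p2 n"
      using B by (intro private_size_le) (simp add: bounded_event_def)
    then have "real (private_size c) \<le> 5 + 4 * real (room p1 p2 n)"
      by linarith
    \<comment> \<open>The constant 5 is absorbed by \<open>5 * sqrt n\<close>.\<close>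
    then show "real (private_size c) \<le> (5 + 4 * b) * sqrt (real n)"
      using room sqrt_ge_1[OF n] unfolding distrib_right mult.assoc by linarith
    show "real (message_size m) \<le> b * sqrt (real n)" if "opn = Some m" for m
      using B that room by (auto simp: bounded_event_def)
    show "real (server_size \<sigma>) \<le> (8 + 64 * (p1 + p2 + 2)) * real n"
      using server_size_le[of p1 p2 n \<sigma>] server_le[OF n pos] B
      unfolding bounded_event_def by (auto intro: order_trans[OF of_nat_mono])
  qed
  show ?thesis
  proof (intro exI conjI)
    show "(\<lambda>n. (5 + 4 * b) * sqrt (real n)) \<in> O(\<lambda>n. sqrt (real n))"
      "(\<lambda>n. b * sqrt (real n)) \<in> O(\<lambda>n. sqrt (real n))"
      "(\<lambda>n. (8 + 64 * (p1 + p2 + 2)) * real n) \<in> O(\<lambda>n. real n)"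
      "(\<lambda>_. 119) \<in> O(\<lambda>_. 1 :: real)"
      by simp_all
  next
    show "\<forall>n \<ge> 1. \<forall>(E :: ('k, 'sd, 'r, 'v, 'c) crypto) k D \<omega> reqs.
       valid_crypto E \<longrightarrow> valid_requests n reqs \<longrightarrow>
         (\<forall>(opn, c, \<sigma>) \<in> set (scheme_trace E p1 p2 n k D \<omega> reqs).
            real (private_size c) \<le> (5 + 4 * b) * sqrt (real n) \<and>
            (\<forall>m. opn = Some m \<longrightarrow> real (message_size m) \<le> b * sqrt (real n)) \<and>
            real (server_size \<sigma>) \<le> (8 + 64 * (p1 + p2 + 2)) * real n) \<and>
         (reqs \<noteq> [] \<longrightarrow> access_overhead E p1 p2 n k D \<omega> reqs \<le> 119)"
    proof (intro allI impI, rule conjI)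
      fix n :: nat and E :: "('k, 'sd, 'r, 'v, 'c) crypto" and k D \<omega> reqs
      assume n: "n \<ge> 1"
      show "\<forall>(opn, c, \<sigma>) \<in> set (scheme_trace E p1 p2 n k D \<omega> reqs).
            real (private_size c) \<le> (5 + 4 * b) * sqrt (real n) \<and>
            (\<forall>m. opn = Some m \<longrightarrow> real (message_size m) \<le> b * sqrt (real n)) \<and>
            real (server_size \<sigma>) \<le> (8 + 64 * (p1 + p2 + 2)) * real n"
        by (intro ballI case_prodI2, rule size[OF n]) simp
      show "reqs \<noteq> [] \<longrightarrow> access_overhead E p1 p2 n k D \<omega> reqs \<le> 119"
        by (rule impI, rule access_overhead_le[OF n])
    qed
  qed
qed

end
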